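(* Let $\{v_k\}_{k\ge 0}\subset\mathbb{R}^n$ be the sequence generated by a general semismooth Newton method for the equation $r(v)=0$, where $r(v)=v-Dv$ is the risk-averse Bellman residual function, with family of approximations $\Xi$. Assume that for every $\xi(v,\cdot)\in\Xi(v)$: (1) $\xi(v,\cdot)$ is a uniform Lipschitz homeomorphism for all $v\in\mathbb{R}^n$, and $L_\Xi\ge 0$ is the Lipschitz modulus of the inverse; (2) there exist a neighborhood $\mathcal{U}'_{v^*}\subseteq\mathbb{R}^n$ of $v^*$ and a constant $C_\Xi\ge 0$ such that for all $v\in\mathcal{U}'_{v^*}$ $$\Vert r(v)+\xi(v,\,v^*-v)-r(v^* )\Vert\le C_\Xi\,\Vert v-v^*\Vert^2 .$$ In addition, let $$\mathcal{U}''_{v^*}=\{v\in\mathcal{U}'_{v^*}\ :\ \Vert v-v^*\Vert<1/(L_\Xi C_\Xi)\}.$$ Then, if $v_0\in\mathcal{U}''_{v^*}$, the sequence $\{v_k\}$ converges Q-quadratically to $v^*$.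
   Context: Setting. $\mathcal{S}=\{1,\dots,n\}$ and $\mathcal{A}=\{1,\dots,m\}$ are finite state and action sets, $\mathcal{A}(i)\subseteq\mathcal{A}$ is the nonempty set of actions allowed in state $i$, $\gamma\in(0,1)$ is the discount factor, $\mathbb{S}^n$ is the probability simplex in $\mathbb{R}^n$, $P:\mathcal{S}\times\mathcal{A}\to\mathbb{S}^n$ is the controlled kernel and $g:\mathcal{S}\times\mathcal{A}\to[-R,R]$, $R>0$, is the stage cost. The risk-transition mapping $\chi:\mathbb{R}^n\times\mathbb{S}^n\to\mathbb{R}$ satisfies: for every $(i,a)$ there is a nonempty compact convex set $\mathcal{P}_\chi(P(i,a))\subset\mathbb{S}^n$ such that $\chi(v,P(i,a))=\max_{\tilde p\in\mathcal{P}_\chi(P(i,a))}\langle v,\tilde p\rangle$ for all $v\in\mathbb{R}^n$. The risk-averse Bellman operator $D:\mathbb{R}^n\to\mathbb{R}^n$ is $(Dv)(i)=\min_{a\in\mathcal{A}(i)}\{g(i,a)+\gamma\,\chi(v,P(i,a))\}$, $i\in\mathcal{S}$. It is a $\gamma$-contraction in the infinity norm, and $v^*$ denotes its unique fixed point (the optimal risk-averse cost), i.e. the unique root of $r$. General semismooth Newton method. For each $v\in\mathbb{R}^n$, $\Xi(v)$ is a nonempty family of functions $\xi(v,\cdot):\mathbb{R}^n\to\mathbb{R}^n$, such that every $\xi(v,\cdot)\in\Xi(v)$ satisfies $\xi(v,0)=0$, is invertible, and $d=\xi^{-1}(v,-r(v))$ is the unique solution of $r(v)+\xi(v,d)=0$,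 where $\xi^{-1}(v,\cdot)$ is the inverse of $\xi(v,\cdot)$. Starting from $v_0\in\mathbb{R}^n$, at each iteration $k\ge 0$ the method picks some $\xi(v_k,\cdot)\in\Xi(v_k)$, computes $d_k$ with $r(v_k)+\xi(v_k,d_k)=0$, and sets $v_{k+1}=v_k+d_k$. Terminology. $\Vert\cdot\Vert$ is a fixed norm on $\mathbb{R}^n$. A Lipschitz homeomorphism of $\mathbb{R}^n$ is a bijection $\mathbb{R}^n\to\mathbb{R}^n$ that is Lipschitz continuous with Lipschitz continuous inverse. "Uniform" with modulus $L_\Xi$ means that the single constant $L_\Xi$ is a Lipschitz constant of $\xi^{-1}(v,\cdot)$ for all $v\in\mathbb{R}^n$ and all $\xi(v,\cdot)\in\Xi(v)$. Likewise $\mathcal{U}'_{v^*}$ and $C_\Xi$ are the same for all elements of the families. If $L_\Xi C_\Xi=0$, then $1/(L_\Xi C_\Xi)$ is read as $+\infty$. A sequence converges Q-quadratically to $v^*$ if $v_k\to v^*$ and there is a constant $C\ge 0$ with $\Vert v_{k+1}-v^*\Vert\le C\Vert v_k-v^*\Vert^2$ for all sufficiently large $k$.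
   Formalization: The neighborhood U' of v* is taken to be an open or closed ball around v* in the fixed norm, or all of R^n; for an arbitrary neighborhood the claim fails, since an iterate may leave U' and then cycle. *)

theory Defs
  imports "HOL-Analysis.Analysis"
begin

definition prob_simplex :: "(real ^ 's) set" where
  "prob_simplex = {p. (\<forall>i. 0 \<le> p $ i) \<and> (\<Sum>i\<in>UNIV. p $ i) = 1}"

(* The value is required to be attained on Q and to bound Q from above, that is, to be a maximum. *)
definition risk_transition_mapping ::
    "(real ^ 's \<Rightarrow> real ^ 's \<Rightarrow> real) \<Rightarrow> ('s \<Rightarrow> 'a \<Rightarrow> real ^ 's) \<Rightarrow> bool" where
  "risk_transition_mapping rho P \<longleftrightarrow>
     (\<forall>i a. \<exists>Q. Q \<noteq> {} \<and> compact Q \<and> convex Q \<and> Q \<subseteq> prob_simplex \<and>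
        (\<forall>v. rho v (P i a) \<in> (\<lambda>q. v \<bullet> q) ` Q \<and> (\<forall>q\<in>Q. v \<bullet> q \<le> rho v (P i a))))"

definition risk_bellman ::
    "('s \<Rightarrow> 'a set) \<Rightarrow> real \<Rightarrow> ('s \<Rightarrow> 'a \<Rightarrow> real ^ 's) \<Rightarrow> ('s \<Rightarrow> 'a \<Rightarrow> real) \<Rightarrow>
     (real ^ 's \<Rightarrow> real ^ 's \<Rightarrow> real) \<Rightarrow> real ^ 's \<Rightarrow> real ^ 's" where
  "risk_bellman A \<gamma> P g rho v =
     (\<chi> i. Min ((\<lambda>a. g i a + \<gamma> * rho v (P i a)) ` A i))"

definition risk_residual ::
    "('s \<Rightarrow> 'a set) \<Rightarrow> real \<Rightarrow> ('s \<Rightarrow> 'a \<Rightarrow> real ^ 's) \<Rightarrow> ('s \<Rightarrow> 'a \<Rightarrow> real) \<Rightarrow>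
     (real ^ 's \<Rightarrow> real ^ 's \<Rightarrow> real) \<Rightarrow> real ^ 's \<Rightarrow> real ^ 's" where
  "risk_residual A \<gamma> P g rho v = v - risk_bellman A \<gamma> P g rho v"

(* Well defined by risk_bellman_unique_fixed_point below. *)
definition risk_optimal_cost ::
    "('s \<Rightarrow> 'a set) \<Rightarrow> real \<Rightarrow> ('s \<Rightarrow> 'a \<Rightarrow> real ^ 's) \<Rightarrow> ('s \<Rightarrow> 'a \<Rightarrow> real) \<Rightarrow>
     (real ^ 's \<Rightarrow> real ^ 's \<Rightarrow> real) \<Rightarrow> real ^ 's" where
  "risk_optimal_cost A \<gamma> P g rho = (THE v. risk_bellman A \<gamma> P g rho v = v)"

lemma risk_transition_mapping_le:
  fixes v w :: "real ^ 's"
  assumes "risk_transition_mapping rho P"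
  shows "rho v (P i a) \<le> rho w (P i a) + infnorm (v - w)"
proof -
  obtain Q where Q: "Q \<subseteq> prob_simplex"
    and m: "\<And>v. rho v (P i a) \<in> (\<lambda>q. v \<bullet> q) ` Q \<and> (\<forall>q\<in>Q. v \<bullet> q \<le> rho v (P i a))"
    using assms unfolding risk_transition_mapping_def by metis
  obtain q where q: "q \<in> Q" "rho v (P i a) = v \<bullet> q" using m[of v] by auto
  have p: "\<And>j. 0 \<le> q $ j" "(\<Sum>j\<in>UNIV. q $ j) = 1"
    using Q q(1) by (auto simp: prob_simplex_def)
  have "(v - w) \<bullet> q = (\<Sum>j\<in>UNIV. (v - w) $ j * q $ j)" by (simp add: inner_vec_def)
  also have "\<dots> \<le> (\<Sum>j\<in>UNIV. infnorm (v - w) * q $ j)"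
    using component_le_infnorm_cart[of "v - w"] p(1)
    by (intro sum_mono mult_right_mono) (auto intro: order_trans[OF abs_ge_self])
  also have "\<dots> = infnorm (v - w)" by (simp add: sum_distrib_left[symmetric] p(2))
  finally have "v \<bullet> q \<le> w \<bullet> q + infnorm (v - w)" by (simp add: inner_diff_left)
  moreover have "w \<bullet> q \<le> rho w (P i a)" using m[of w] q(1) by auto
  ultimately show ?thesis using q(2) by linarith
qed

lemma risk_bellman_contraction:
  fixes v w :: "real ^ 's" and A :: "'s::finite \<Rightarrow> 'a::finite set"
  assumes "\<And>i. A i \<noteq> {}" "0 < \<gamma>" "risk_transition_mapping rho P"
  shows "infnorm (risk_bellman A \<gamma> P g rho v - risk_bellman A \<gamma> P g rho w)
           \<le> \<gamma> * infnorm (v - w)"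
proof -
  have le: "risk_bellman A \<gamma> P g rho v $ i \<le> risk_bellman A \<gamma> P g rho w $ i + \<gamma> * infnorm (v - w)"
    for v w :: "real ^ 's" and i
  proof -
    let ?f = "\<lambda>v a. g i a + \<gamma> * rho v (P i a)"
    have "Min (?f w ` A i) \<in> ?f w ` A i" by (rule Min_in) (use assms(1) in auto)
    then obtain a where a: "a \<in> A i" "Min (?f w ` A i) = ?f w a" by auto
    have "Min (?f v ` A i) \<le> ?f v a" by (rule Min_le) (use a in auto)
    also have "\<dots> \<le> ?f w a + \<gamma> * infnorm (v - w)"
      using mult_left_mono[OF risk_transition_mapping_le[OF assms(3), of v i a w], of \<gamma>] assms(2)
      by (simp add: algebra_simps)
    finally show ?thesis using a(2) by (simp add: risk_bellman_def)
  qed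
  have "\<bar>(risk_bellman A \<gamma> P g rho v - risk_bellman A \<gamma> P g rho w) $ i\<bar> \<le> \<gamma> * infnorm (v - w)" for i
    using le[of v i w] le[of w i v] by (simp add: abs_le_iff infnorm_sub[of w v])
  then show ?thesis unfolding infnorm_cart by (intro cSup_least) (auto simp: infnorm_cart)
qed

lemma risk_bellman_unique_fixed_point:
  fixes A :: "'s::finite \<Rightarrow> 'a::finite set"
  assumes "\<And>i. A i \<noteq> {}" "0 < \<gamma>" "\<gamma> < 1" "risk_transition_mapping rho P"
  shows "\<exists>!v. risk_bellman A \<gamma> P g rho v = v"
proof -
  let ?D = "risk_bellman A \<gamma> P g rho"
  have it: "infnorm ((?D ^^ k) x - (?D ^^ k) y) \<le> \<gamma> ^ k * infnorm (x - y)" for k x y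
  proof (induction k)
    case (Suc k)
    have "infnorm ((?D ^^ Suc k) x - (?D ^^ Suc k) y) \<le> \<gamma> * infnorm ((?D ^^ k) x - (?D ^^ k) y)"
      using risk_bellman_contraction[of A \<gamma> rho P g] assms by simp
    also have "\<dots> \<le> \<gamma> * (\<gamma> ^ k * infnorm (x - y))"
      using Suc assms(2) by (intro mult_left_mono) auto
    finally show ?case by (simp add: mult.assoc)
  qed auto
  define s where "s = sqrt DIM(real ^ 's)"
  have s: "s > 0" by (simp add: s_def)
  obtain k where k: "\<gamma> ^ k < 1 / (2 * s)"
    using real_arch_pow_inv[of "1 / (2 * s)" \<gamma>] s assms(3) by auto
  have "dist ((?D ^^ k) x) ((?D ^^ k) y) \<le> 1 / 2 * dist x y" for x y
  proof -
    have "norm ((?D ^^ k) x - (?D ^^ k) y) \<le> s * infnorm ((?D ^^ k) x - (?D ^^ k) y)"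
      unfolding s_def by (rule norm_le_infnorm)
    also have "\<dots> \<le> s * (\<gamma> ^ k * infnorm (x - y))"
      using it s by (intro mult_left_mono) auto
    also have "\<dots> \<le> s * (1 / (2 * s) * norm (x - y))"
      using k s assms(2) by (intro mult_left_mono mult_mono infnorm_le_norm infnorm_pos_le) auto
    finally show ?thesis using s by (simp add: dist_norm)
  qed
  then have ex1: "\<exists>!x. (?D ^^ k) x = x"
    using Banach_fix[of UNIV "1/2" "?D ^^ k"] by (simp add: complete_UNIV)
  then obtain x where x: "(?D ^^ k) x = x" by auto
  have "(?D ^^ k) (?D x) = ?D x" using x by (metis funpow_swap1)
  then have "?D x = x" using x ex1 by auto
  moreover have "y = x" if "?D y = y" for y
    proof -
    have "(?D ^^ k) y = y" by (induction k) (simp_all add: that)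
    then show ?thesis using x ex1 by blast
  qed
  ultimately show ?thesis by blast
qed

definition is_norm :: "('v::real_vector \<Rightarrow> real) \<Rightarrow> bool" where
  "is_norm N \<longleftrightarrow>
     (\<forall>x. 0 \<le> N x \<and> (N x = 0 \<longleftrightarrow> x = 0)) \<and>
     (\<forall>c x. N (c *\<^sub>R x) = \<bar>c\<bar> * N x) \<and>
     (\<forall>x y. N (x + y) \<le> N x + N y)"

definition lipschitz_wrt :: "('v::real_vector \<Rightarrow> real) \<Rightarrow> real \<Rightarrow> ('v \<Rightarrow> 'v) \<Rightarrow> bool" where
  "lipschitz_wrt N L f \<longleftrightarrow> 0 \<le> L \<and> (\<forall>x y. N (f x - f y) \<le> L * N (x - y))"

definition lipschitz_homeo_wrt :: "('v::real_vector \<Rightarrow> real) \<Rightarrow> real \<Rightarrow> ('v \<Rightarrow> 'v) \<Rightarrow> bool" where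
  "lipschitz_homeo_wrt N L f \<longleftrightarrow> bij f \<and> (\<exists>K. lipschitz_wrt N K f) \<and> lipschitz_wrt N L (inv f)"

(* Neighborhoods are norm balls around x, open or closed, or the whole space. For an arbitrary
   neighborhood an iterate could leave it, and nothing would control the method from there on. *)
definition ball_neighborhood :: "('v::real_vector \<Rightarrow> real) \<Rightarrow> 'v \<Rightarrow> 'v set \<Rightarrow> bool" where
  "ball_neighborhood N x U \<longleftrightarrow>
     (\<exists>\<delta>>0. U = {v. N (v - x) < \<delta>} \<or> U = {v. N (v - x) \<le> \<delta>}) \<or> U = UNIV"

definition newton_family ::
    "('v::real_vector \<Rightarrow> 'v) \<Rightarrow> ('v \<Rightarrow> ('v \<Rightarrow> 'v) set) \<Rightarrow> bool" where
  "newton_family r \<Xi> \<longleftrightarrow>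
     (\<forall>v. \<Xi> v \<noteq> {} \<and>
        (\<forall>\<xi>\<in>\<Xi> v. \<xi> 0 = 0 \<and> bij \<xi> \<and> (\<forall>d. r v + \<xi> d = 0 \<longleftrightarrow> d = inv \<xi> (- r v))))"

definition newton_sequence ::
    "('v::real_vector \<Rightarrow> 'v) \<Rightarrow> ('v \<Rightarrow> ('v \<Rightarrow> 'v) set) \<Rightarrow> (nat \<Rightarrow> 'v) \<Rightarrow> bool" where
  "newton_sequence r \<Xi> v \<longleftrightarrow>
     (\<forall>k. \<exists>\<xi>\<in>\<Xi> (v k). \<exists>d. r (v k) + \<xi> d = 0 \<and> v (Suc k) = v k + d)"

definition Q_quadratic_convergence ::
    "('v::real_normed_vector \<Rightarrow> real) \<Rightarrow> (nat \<Rightarrow> 'v) \<Rightarrow> 'v \<Rightarrow> bool" where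
  "Q_quadratic_convergence N v x \<longleftrightarrow>
     v \<longlonglongrightarrow> x \<and>
     (\<exists>C\<ge>0. \<forall>\<^sub>F k in sequentially. N (v (Suc k) - x) \<le> C * (N (v k - x))\<^sup>2)"

(* The first disjunct covers the convention 1 / (L C) = \<infinity> for L C = 0, where HOL has 1 / 0 = 0. *)
definition newton_start_region ::
    "('v::real_vector \<Rightarrow> real) \<Rightarrow> real \<Rightarrow> real \<Rightarrow> 'v set \<Rightarrow> 'v \<Rightarrow> 'v set" where
  "newton_start_region N L C U x = {v \<in> U. L * C = 0 \<or> N (v - x) < 1 / (L * C)}"

end

theory Submission
  imports Defs
begin

text \<open>
  The proof is the local error analysis of Newton's method. Write \<open>x\<close> for the root and
  \<open>e k = N (v k - x)\<close> for the error. Both the Newton step \<open>d\<close> and the ideal step \<open>x - v k\<close>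
  are preimages under the same homeomorphism \<open>\<xi>\<close>: the former of \<open>- r (v k)\<close>, the latter of
  \<open>\<xi> (x - v k)\<close>. Hence the new error, which is the distance between these two steps, is at
  most \<open>L\<close> times the distance between the images, and because \<open>r x = 0\<close> that distance is
  exactly the approximation defect bounded by \<open>C * (e k)\<^sup>2\<close>
  (\<open>newton_step_error\<close>). So \<open>e (Suc k) \<le> L * C * (e k)\<^sup>2\<close> as long as the iterates stay where
  the defect bound is valid.

  The start region makes \<open>q = L * C * e 0\<close> smaller than 1, so the quadratic bound also gives
  \<open>e (Suc k) \<le> q * e k\<close>. The errors therefore never increase, the iterates stay in
  \<open>U\<close>, which is a ball around \<open>x\<close> or the whole space, and \<open>e k \<le> q ^ k * e 0\<close> tends
  to 0. To turn this into topological convergence, \<open>N\<close> is compared with the Euclidean norm,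
  using compactness of the unit sphere (\<open>is_norm_bounds_norm\<close>).

  For the Bellman residual, \<open>r x = 0\<close> holds because the optimal cost is the fixed point of the
  Bellman operator, which exists and is unique because that operator is a contraction.
\<close>

lemma is_norm_minus:
  assumes "is_norm N"
  shows "N (- x) = N x"
proof -
  have "N ((-1) *\<^sub>R x) = \<bar>-1\<bar> * N x"
    using assms unfolding is_norm_def by blast
  then show ?thesis by simp
qed

lemma is_norm_convex_on:
  assumes "is_norm N"
  shows "convex_on UNIV N"
proof (rule convex_onI)
  fix t :: real and x y
  assume t: "0 < t" "t < 1"
  have "N ((1 - t) *\<^sub>R x + t *\<^sub>R y) \<le> N ((1 - t) *\<^sub>R x) + N (t *\<^sub>R y)"
    using assms unfolding is_norm_def by blast
  also have "\<dots> = \<bar>1 - t\<bar> * N x + \<bar>t\<bar> * N y"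
    using assms unfolding is_norm_def by metis
  also have "\<dots> = (1 - t) * N x + t * N y"
    using t by simp
  finally show "N ((1 - t) *\<^sub>R x + t *\<^sub>R y) \<le> (1 - t) * N x + t * N y" .
qed simp

text \<open>
  The nontrivial half of the equivalence of norms in finite dimension. Being convex, \<open>N\<close> is
  continuous, so it attains a minimum on the compact unit sphere; the minimum is positive by
  definiteness and serves as the constant by homogeneity.
\<close>

lemma is_norm_bounds_norm:
  fixes N :: "'v::euclidean_space \<Rightarrow> real"
  assumes "is_norm N"
  obtains c where "c > 0" and "\<And>x. c * norm x \<le> N x"
proof -
  have "continuous_on UNIV N"
    using convex_on_continuous[OF open_UNIV is_norm_convex_on[OF assms]] .
  then have "continuous_on (sphere 0 1) N"
    by (rule continuous_on_subset) simp
  moreover have "sphere (0::'v) 1 \<noteq> {}"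
    by simp
  ultimately obtain u where u: "u \<in> sphere 0 1" and min: "\<And>y. y \<in> sphere 0 1 \<Longrightarrow> N u \<le> N y"
    using continuous_attains_inf[OF compact_sphere] by metis
  have "u \<noteq> 0" using u by auto
  then have "N u > 0"
    using assms unfolding is_norm_def by (metis order_le_less)
  moreover have "N u * norm x \<le> N x" for x
  proof (cases "x = 0")
    case True
    then show ?thesis using assms by (simp add: is_norm_def)
  next
    case False
    then have "N u \<le> N ((1 / norm x) *\<^sub>R x)"
      by (intro min) simp
    also have "\<dots> = \<bar>1 / norm x\<bar> * N x"
      using assms unfolding is_norm_def by blast
    finally show ?thesis using False by (simp add: field_simps)
  qed
  ultimately show ?thesis by (rule that)
qed

lemma tendsto_if_is_norm_tendsto_zero:
  fixes N :: "'v::euclidean_space \<Rightarrow> real"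
  assumes "is_norm N" and "(\<lambda>k. N (v k - x)) \<longlonglongrightarrow> 0"
  shows "v \<longlonglongrightarrow> x"
proof -
  obtain c where c: "c > 0" "\<And>x. c * norm x \<le> N x"
    using is_norm_bounds_norm[OF assms(1)] by metis
  have "norm (v k - x) \<le> N (v k - x) / c" for k
    using c(2)[of "v k - x"] c(1) by (simp add: field_simps)
  moreover have "(\<lambda>k. N (v k - x) / c) \<longlonglongrightarrow> 0"
    using tendsto_divide[OF assms(2) tendsto_const[of c]] c(1) by simp
  ultimately have "(\<lambda>k. v k - x) \<longlonglongrightarrow> 0"
    by (rule Lim_null_comparison[OF always_eventually[OF allI]])
  then show ?thesis by (rule LIM_zero_cancel)
qed

lemma ball_neighborhood_closer:
  assumes "ball_neighborhood N x U" and "y \<in> U" and "N (z - x) \<le> N (y - x)"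
  shows "z \<in> U"
  using assms unfolding ball_neighborhood_def by force

lemma newton_start_region_contraction_factor:
  assumes "y \<in> newton_start_region N L C U x" and "0 \<le> L" and "0 \<le> C"
  shows "L * C * N (y - x) < 1"
proof (cases "L * C = 0")
  case True
  then show ?thesis by (simp only: mult_zero_left zero_less_one)
next
  case False
  then have "L * C > 0" using assms(2,3) by (simp add: less_le)
  then show ?thesis
    using assms(1) False unfolding newton_start_region_def by (auto simp: field_simps)
qed

text \<open>
  The step actually taken and the step that would land on the root differ by at most \<open>L\<close> times
  the difference of their images under \<open>\<xi>\<close>, since \<open>inv \<xi>\<close> is \<open>L\<close>-Lipschitz.
\<close>

lemma newton_step_error:
  assumes N: "is_norm N"
    and \<xi>: "lipschitz_homeo_wrt N L \<xi>"
    and step: "r y + \<xi> d = 0"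
    and root: "r x = 0"
    and "0 \<le> L"
    and defect: "N (r y + \<xi> (x - y) - r x) \<le> C * (N (y - x))\<^sup>2"
  shows "N (y + d - x) \<le> L * C * (N (y - x))\<^sup>2"
proof -
  have bij: "bij \<xi>" and lip: "\<And>a b. N (inv \<xi> a - inv \<xi> b) \<le> L * N (a - b)"
    using \<xi> by (auto simp: lipschitz_homeo_wrt_def lipschitz_wrt_def)
  have inv: "inv \<xi> (\<xi> a) = a" for a
    using bij by (simp add: bij_is_inj)
  have "N (y + d - x) = N (inv \<xi> (\<xi> d) - inv \<xi> (\<xi> (x - y)))"
    by (simp add: inv algebra_simps)
  also have "\<dots> \<le> L * N (\<xi> d - \<xi> (x - y))"
    by (rule lip)
  also have "\<xi> d - \<xi> (x - y) = - (r y + \<xi> (x - y) - r x)"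
    using step root by (simp add: algebra_simps eq_neg_iff_add_eq_0)
  also have "N \<dots> = N (r y + \<xi> (x - y) - r x)"
    by (rule is_norm_minus[OF N])
  also have "L * \<dots> \<le> L * (C * (N (y - x))\<^sup>2)"
    using defect \<open>0 \<le> L\<close> by (rule mult_left_mono)
  finally show ?thesis by (simp add: mult.assoc)
qed

text \<open>
  Local quadratic convergence for an arbitrary equation \<open>r = 0\<close>. Geometric decay of the error and
  membership of the iterates in \<open>U\<close> have to be proved in one induction: the decay keeps the next
  iterate in \<open>U\<close>, and membership in \<open>U\<close> is what allows the next error estimate.
\<close>

theorem newton_sequence_Q_quadratic:
  fixes N :: "'v::euclidean_space \<Rightarrow> real"
  assumes N: "is_norm N"
    and seq: "newton_sequence r \<Xi> v"
    and "0 \<le> L" and "0 \<le> C"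
    and homeo: "\<And>y \<xi>. \<xi> \<in> \<Xi> y \<Longrightarrow> lipschitz_homeo_wrt N L \<xi>"
    and ball: "ball_neighborhood N x U"
    and defect: "\<And>y \<xi>. y \<in> U \<Longrightarrow> \<xi> \<in> \<Xi> y \<Longrightarrow>
      N (r y + \<xi> (x - y) - r x) \<le> C * (N (y - x))\<^sup>2"
    and root: "r x = 0"
    and start: "v 0 \<in> newton_start_region N L C U x"
  shows "Q_quadratic_convergence N v x"
proof -
  define e where "e k = N (v k - x)" for k
  define q where "q = L * C * e 0"
  have e_nonneg: "0 \<le> e k" for k
    using N by (simp add: e_def is_norm_def)
  have q: "0 \<le> q" "q < 1"
    using newton_start_region_contraction_factor[OF start \<open>0 \<le> L\<close> \<open>0 \<le> C\<close>]
      \<open>0 \<le> L\<close> \<open>0 \<le> C\<close> e_nonneg[of 0] by (auto simp: q_def e_def)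
  have quad: "e (Suc k) \<le> L * C * (e k)\<^sup>2" if "v k \<in> U" for k
  proof -
    obtain \<xi> d where \<xi>: "\<xi> \<in> \<Xi> (v k)" "r (v k) + \<xi> d = 0" "v (Suc k) = v k + d"
      using seq unfolding newton_sequence_def by blast
    then show ?thesis
      using newton_step_error[OF N homeo[OF \<xi>(1)] _ root
          \<open>0 \<le> L\<close> defect[OF that \<xi>(1)]]
      by (simp add: e_def)
  qed
  have decay: "v k \<in> U \<and> e k \<le> q ^ k * e 0" for k
  proof (induction k)
    case 0
    then show ?case using start by (simp add: newton_start_region_def)
  next
    case (Suc k)
    have "q ^ k * e 0 \<le> e 0"
      using q e_nonneg[of 0] by (intro mult_left_le_one_le power_le_one) auto
    then have "e k \<le> e 0" using Suc by linarith
    have "e (Suc k) \<le> L * C * e k * e k"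
      using quad Suc by (simp add: power2_eq_square mult.assoc)
    also have "\<dots> \<le> q * e k"
      unfolding q_def using \<open>e k \<le> e 0\<close> e_nonneg \<open>0 \<le> L\<close> \<open>0 \<le> C\<close>
      by (intro mult_right_mono mult_left_mono) auto
    finally have contr: "e (Suc k) \<le> q * e k" .
    also have "\<dots> \<le> e k"
      using q e_nonneg by (intro mult_left_le_one_le) auto
    finally have "v (Suc k) \<in> U"
      using ball_neighborhood_closer[OF ball] Suc by (auto simp: e_def)
    moreover have "q * e k \<le> q * (q ^ k * e 0)"
      using Suc q by (intro mult_left_mono) auto
    ultimately show ?case using contr by (simp add: mult.assoc)
  qed
  have "(\<lambda>k. q ^ k * e 0) \<longlonglongrightarrow> 0"
    using q by (intro tendsto_mult_left_zero LIMSEQ_power_zero) auto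
  then have "e \<longlonglongrightarrow> 0"
    by (rule Lim_null_comparison[rotated]) (use decay e_nonneg in auto)
  then have "v \<longlonglongrightarrow> x"
    unfolding e_def by (rule tendsto_if_is_norm_tendsto_zero[OF N])
  moreover have "0 \<le> L * C"
    using \<open>0 \<le> L\<close> \<open>0 \<le> C\<close> by simp
  moreover have "\<forall>k. N (v (Suc k) - x) \<le> L * C * (N (v k - x))\<^sup>2"
    using quad decay by (simp add: e_def)
  ultimately show ?thesis
    unfolding Q_quadratic_convergence_def
    by (intro conjI exI[of _ "L * C"] always_eventually)
qed

lemma risk_residual_optimal_cost:
  fixes A :: "'s::finite \<Rightarrow> 'a::finite set"
  assumes "\<And>i. A i \<noteq> {}" "0 < \<gamma>" "\<gamma> < 1" "risk_transition_mapping rho P"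
  shows "risk_residual A \<gamma> P g rho (risk_optimal_cost A \<gamma> P g rho) = 0"
  using theI'[OF risk_bellman_unique_fixed_point[OF assms]]
  by (simp add: risk_residual_def risk_optimal_cost_def)

theorem theorem3:
  fixes A :: "'s::finite \<Rightarrow> 'a::finite set"
    and \<gamma> R :: real
    and P :: "'s \<Rightarrow> 'a \<Rightarrow> real ^ 's"
    and g :: "'s \<Rightarrow> 'a \<Rightarrow> real"
    and rho :: "real ^ 's \<Rightarrow> real ^ 's \<Rightarrow> real"
    and N :: "real ^ 's \<Rightarrow> real"
    and \<Xi> :: "real ^ 's \<Rightarrow> (real ^ 's \<Rightarrow> real ^ 's) set"
    and L C :: real
    and U :: "(real ^ 's) set"
    and v :: "nat \<Rightarrow> real ^ 's"
  defines "r \<equiv> risk_residual A \<gamma> P g rho"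
    and "vstar \<equiv> risk_optimal_cost A \<gamma> P g rho"
  assumes "\<And>i. A i \<noteq> {}"
    and "0 < \<gamma>" and "\<gamma> < 1"
    and "\<And>i a. P i a \<in> prob_simplex"
    and "0 < R" and "\<And>i a. g i a \<in> {-R..R}"
    and "risk_transition_mapping rho P"
    and "is_norm N"
    and "newton_family r \<Xi>"
    and "newton_sequence r \<Xi> v"
    and "0 \<le> L"
    and "\<And>x \<xi>. \<xi> \<in> \<Xi> x \<Longrightarrow> lipschitz_homeo_wrt N L \<xi>"
    and "ball_neighborhood N vstar U"
    and "0 \<le> C"
    and "\<And>x \<xi>. x \<in> U \<Longrightarrow> \<xi> \<in> \<Xi> x \<Longrightarrow>
           N (r x + \<xi> (vstar - x) - r vstar) \<le> C * (N (x - vstar))\<^sup>2"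
    and "v 0 \<in> newton_start_region N L C U vstar"
  shows "Q_quadratic_convergence N v vstar"
proof -
  have root: "r vstar = 0"
    unfolding r_def vstar_def by (rule risk_residual_optimal_cost) fact+
  show ?thesis
    by (rule newton_sequence_Q_quadratic[where r = r and \<Xi> = \<Xi> and L = L and C = C and U = U])
      (fact | rule root)+
qed

end
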